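(* Let $S=\{(\mathbf{x}^i,y^i)\}_{i=1}^n$ be i.i.d. from an unknown distribution $\mathbb{P}_{\mathbf{x},y}$ on $\mathcal{X}\times\mathcal{Y}$, and let $(\tilde{\mathbf{x}}^j,\tilde y^j)$, $j=1,\dots,m$, be i.i.d. from $\mathbb{P}_{\mathbf{x},y}$ and independent of $S$. Let $\mathcal{B}_0$ be a class of prediction models $\beta:\mathcal{X}\to\mathcal{Y}$ and let $l$ be a loss function with values $l(\beta(\mathbf{x}),y)\in[0,M]$. Put $l_{\mathbb{P}}(\beta)=\mathbb{E}_{\mathbf{x},y}[l(\beta(\mathbf{x}),y)]$ and $l_S(\beta)=\frac1n\sum_{i=1}^n l(\beta(\mathbf{x}^i),y^i)$, and let $\beta^*\in\arg\min_{\beta\in\mathcal{B}_0}l_{\mathbb{P}}(\beta)$ and $\beta^{\mathrm{Alg}}\in\arg\min_{\beta\in\mathcal{B}_0}l_S(\beta)$. Let $E\subseteq\mathcal{Y}$ and $\delta_e\in[0,1]$ satisfy $$\mathbb{P}_{\mathbf{x},y}\big(|y-\beta^*(\mathbf{x})|\in E\big)\ge1-\delta_e .$$ Let $\delta\in(0,1)$ and define $$\mathcal{B}=\left\{\beta\in\mathcal{B}_0:\ l_S(\beta)\le l_S(\beta^{\mathrm{Alg}})+2\mathcal{R}_S(l\circ\mathcal{B}_0)+4M\sqrt{\frac{\log\frac3\delta}{2n}}\right\},$$ $$\mathcal{U}=\prod_{j=1}^m\Big[\inf\{\beta(\tilde{\mathbf{x}}^j):\beta\in\mathcal{B}\}-\sup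 E,\ \ \sup\{\beta(\tilde{\mathbf{x}}^j):\beta\in\mathcal{B}\}+\sup E\Big].$$ Let $\pi^*$ be an optimal solution of the robust problem $$\min_{\pi\in\Pi}\max_{\mathbf{u}\in\mathcal{U}} f(\pi,\mathbf{u})\quad\text{s.t.}\quad F(\pi,\mathbf{u})\in\mathcal{K}\ \text{ for all }\mathbf{u}\in\mathcal{U}.$$ Then: 1. With probability at least $1-\delta$ (over $S$), $\beta^*\in\mathcal{B}$. 2. $\pi^*$ is feasible for $\{(\tilde{\mathbf{x}}^j,\tilde y^j)\}_{j=1}^m$ with probability at least $(1-\delta)(1-\delta_e)^m$ over $\{(\tilde{\mathbf{x}}^j,\tilde y^j)\}_{j=1}^m$ and $S$; that is, $$\mathbb{P}_{S,\{(\tilde{\mathbf{x}}^j,\tilde y^j)\}_{j=1}^m}\big(F(\pi^*,[\tilde y^1\cdots\tilde y^m]^T)\in\mathcal{K}\big)\ge(1-\delta)(1-\delta_e)^m .$$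
   Context: $\mathcal{X}\subseteq\mathbb{R}^d$ is the feature space and $\mathcal{Y}\subseteq\mathbb{R}$ the label space. The minimizers $\beta^*$ and $\beta^{\mathrm{Alg}}$ are assumed to exist. If an endpoint of an interval in $\mathcal{U}$ is infinite, the interval is the corresponding unbounded interval in $\mathbb{R}$; $\sup\emptyset:=0$. Decision problem: $\Pi\subseteq\mathbb{R}^{d_1}$ is the set of decisions, $f:\Pi\times\mathbb{R}^m\to\mathbb{R}$ the objective, $F:\Pi\times\mathbb{R}^m\to\mathbb{R}^{d_2}$ the constraint function, and $\mathcal{K}\subseteq\mathbb{R}^{d_2}$ a convex cone. The solution $\pi^*$ (assumed to exist) depends on $S$ and on $\tilde{\mathbf{x}}^1,\dots,\tilde{\mathbf{x}}^m$ through $\mathcal{U}$. Empirical Rademacher average: for a class $\mathcal{F}$ of real-valued functions and a sample $S'=\{z^i\}_{i=1}^n$, $\mathcal{R}_{S'}(\mathcal{F})=\mathbb{E}_{\sigma^1,\dots,\sigma^n}\big[\frac1n\sup_{g\in\mathcal{F}}\big|\sum_{i=1}^n\sigma^i g(z^i)\big|\big]$, where the $\sigma^i$ are independent and equal to $\pm1$ with probability $1/2$ each. Here $\mathcal{R}_S(l\circ\mathcal{B}_0)$ is taken for $l\circ\mathcal{B}_0=\{(\mathbf{x},y)\mapsto l(\beta(\mathbf{x}),y):\beta\in\mathcal{B}_0\}$ with $z^i=(\mathbf{x}^i,y^i)$. Convention: all sets, functions, suprema and data-dependent selections are taken to be measurable as needed for the probabilities and expectations to make sense. *)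

theory Defs
  imports "HOL-Probability.Probability"
begin

section \<open>Empirical and expected loss\<close>

text \<open>A sample of size \<open>n\<close> is a function on \<open>nat\<close> of which only the values at
  \<open>0, \<dots>, n - 1\<close> are used. The class \<open>l \<circ> \<B>\<^sub>0\<close> is \<open>loss_of l ` B0\<close>.\<close>

definition loss_of :: "(real \<Rightarrow> real \<Rightarrow> real) \<Rightarrow> ('x \<Rightarrow> real) \<Rightarrow> 'x \<times> real \<Rightarrow> real" where
  "loss_of l \<beta> = (\<lambda>(x, y). l (\<beta> x) y)"

definition expected_loss ::
    "('x \<times> real) measure \<Rightarrow> (real \<Rightarrow> real \<Rightarrow> real) \<Rightarrow> ('x \<Rightarrow> real) \<Rightarrow> real" where
  "expected_loss D l \<beta> = (LINT z|D. loss_of l \<beta> z)"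

definition empirical_loss ::
    "nat \<Rightarrow> (nat \<Rightarrow> 'x \<times> real) \<Rightarrow> (real \<Rightarrow> real \<Rightarrow> real) \<Rightarrow> ('x \<Rightarrow> real) \<Rightarrow> real" where
  "empirical_loss n S l \<beta> = (1 / real n) * (\<Sum>i<n. loss_of l \<beta> (S i))"

text \<open>The supremum below is the real-valued one, so it is meaningful only for a nonempty class
  that is bounded at each of the sample points.\<close>

definition rademacher_sup :: "nat \<Rightarrow> ('z \<Rightarrow> real) set \<Rightarrow> (nat \<Rightarrow> real) \<Rightarrow> (nat \<Rightarrow> 'z) \<Rightarrow> real" where
  "rademacher_sup n G \<sigma> z = (SUP g\<in>G. \<bar>\<Sum>i<n. \<sigma> i * g (z i)\<bar>)"

definition rademacher_avg :: "nat \<Rightarrow> (nat \<Rightarrow> 'z) \<Rightarrow> ('z \<Rightarrow> real) set \<Rightarrow> real" where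
  "rademacher_avg n z G =
     measure_pmf.expectation (Pi_pmf {..<n} 0 (\<lambda>_. pmf_of_set {-1, 1}))
       (\<lambda>\<sigma>. (1 / real n) * rademacher_sup n G \<sigma> z)"


section \<open>The set of good models and the uncertainty set\<close>

definition good_models ::
    "nat \<Rightarrow> (nat \<Rightarrow> 'x \<times> real) \<Rightarrow> (real \<Rightarrow> real \<Rightarrow> real) \<Rightarrow> real \<Rightarrow> real
     \<Rightarrow> ('x \<Rightarrow> real) set \<Rightarrow> ('x \<Rightarrow> real) \<Rightarrow> ('x \<Rightarrow> real) set" where
  "good_models n S l M \<delta> B0 \<beta>alg =
     {\<beta> \<in> B0. empirical_loss n S l \<beta> \<le>
        empirical_loss n S l \<beta>alg + 2 * rademacher_avg n S (loss_of l ` B0)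
        + 4 * M * sqrt (ln (3 / \<delta>) / (2 * real n))}"

text \<open>Supremum of a set of reals in the extended reals, with value 0 (and not \<open>-\<infinity>\<close>) at the
  empty set.\<close>

definition ext_sup :: "real set \<Rightarrow> ereal" where
  "ext_sup A = (if A = {} then 0 else (SUP a\<in>A. ereal a))"

text \<open>The endpoints are extended reals; comparing \<open>ereal (u $ j)\<close> with them yields the
  corresponding unbounded interval when an endpoint is infinite. For nonempty \<open>B\<close> no
  \<open>\<infinity> - \<infinity>\<close> occurs, since then the infimum is below \<open>\<infinity>\<close> and both suprema are above
  \<open>-\<infinity>\<close>.\<close>

definition uncertainty_set ::
    "('x \<Rightarrow> real) set \<Rightarrow> real set \<Rightarrow> ('m::finite \<Rightarrow> 'x) \<Rightarrow> (real ^ 'm) set" where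
  "uncertainty_set B E xt =
     {u. \<forall>j. (INF \<beta>\<in>B. ereal (\<beta> (xt j))) - ext_sup E \<le> ereal (u $ j) \<and>
             ereal (u $ j) \<le> ext_sup ((\<lambda>\<beta>. \<beta> (xt j)) ` B) + ext_sup E}"


section \<open>The robust problem\<close>

definition worst_case :: "('p \<Rightarrow> 'u \<Rightarrow> real) \<Rightarrow> 'u set \<Rightarrow> 'p \<Rightarrow> ereal" where
  "worst_case f U p = ext_sup (f p ` U)"

definition robust_feasible ::
    "'p set \<Rightarrow> ('p \<Rightarrow> 'u \<Rightarrow> 'c) \<Rightarrow> 'c set \<Rightarrow> 'u set \<Rightarrow> 'p \<Rightarrow> bool" where
  "robust_feasible P F K U p \<longleftrightarrow> p \<in> P \<and> (\<forall>u\<in>U. F p u \<in> K)"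

definition robust_optimal ::
    "'p set \<Rightarrow> ('p \<Rightarrow> 'u \<Rightarrow> real) \<Rightarrow> ('p \<Rightarrow> 'u \<Rightarrow> 'c) \<Rightarrow> 'c set \<Rightarrow> 'u set \<Rightarrow> 'p \<Rightarrow> bool" where
  "robust_optimal P f F K U p \<longleftrightarrow> is_arg_min (worst_case f U) (robust_feasible P F K U) p"

end

theory Submission
  imports Defs
begin

text \<open>
  Write \<open>t = 4M sqrt (ln (3/\<delta>) / (2n))\<close> and \<open>R\<close> for the empirical Rademacher average of the loss class.
  The minimizer \<open>\<beta>star\<close> can miss the set of good models only if its empirical loss exceeds that of
  \<open>\<beta>alg\<close> by more than \<open>2R + t\<close>. Since the expected loss of \<open>\<beta>star\<close> is at most that of \<open>\<beta>alg\<close>, this forces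
  two deviations to be large together: empirical minus expected loss of the fixed function \<open>\<beta>star\<close>,
  and expected minus empirical loss of some member of the class.

  The second one is a supremum over the class. It need not be measurable, and it is replaced here
  by the expectation, over an independent ghost sample, of the largest difference between the empirical
  means on the two samples (\<open>ghost_deviation\<close>). This is measurable by Fubini, dominates the one-sided deviation
  of each member of the class by Jensen (\<open>ghost_deviation_ge\<close>), and its expectation is at most twice that
  of \<open>R\<close> by symmetrization (\<open>expectation_ghost_deviation_le\<close>).

  So the sum of the two deviations minus \<open>2R\<close> (\<open>excess_deviation\<close>) has nonpositive expectation, and
  replacing one sample point changes it by at most \<open>M/n + M/n + 2M/n = 4M/n\<close>. McDiarmid's inequality,
  applied once, bounds the probability that it exceeds \<open>t\<close> by \<open>\<delta>/3\<close>.

  For the second claim, if \<open>\<beta>star\<close> is a good model and every residual of \<open>\<beta>star\<close> on the new sample lies in \<open>E\<close>,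
  then the vector of new labels is in the uncertainty set (\<open>in_uncertainty_set\<close>), where the robust solution is
  feasible by definition. The event that \<open>\<beta>star\<close> is good is pulled back from a possibly nonmeasurable set of
  samples, so independence is applied to the event that \<open>excess_deviation\<close> is at most \<open>t\<close> instead: it implies
  that \<open>\<beta>star\<close> is good and is determined by a measurable set of samples (\<open>prob_two_samples\<close>).
\<close>

section \<open>Bounded differences\<close>

lemma (in prob_space) integrable_if_bounded:
  fixes h :: "'a \<Rightarrow> real"
  assumes "h \<in> borel_measurable M" and "\<And>x. x \<in> space M \<Longrightarrow> \<bar>h x\<bar> \<le> B"
  shows "integrable M h"
  using assms by (intro integrable_const_bound[where B = B]) auto

lemma (in prob_space) abs_expectation_le:
  fixes h :: "'a \<Rightarrow> real"
  assumes "h \<in> borel_measurable M" and "\<And>x. x \<in> space M \<Longrightarrow> \<bar>h x\<bar> \<le> B"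
  shows "\<bar>expectation h\<bar> \<le> B"
proof -
  have "integrable M h"
    using assms by (rule integrable_if_bounded)
  then have "expectation h \<le> B" "-B \<le> expectation h"
    using assms(2) by (auto intro!: integral_le_const integral_ge_const AE_I2 simp: abs_le_iff minus_le_iff)
  then show ?thesis by linarith
qed

text \<open>Hoeffding's lemma, with the interval located by the infimum of \<open>h\<close>: the McDiarmid induction controls the
  oscillation of the slices of a function but not the position of their range.\<close>

lemma (in prob_space) nn_integral_exp_le_of_oscillation:
  fixes h :: "'a \<Rightarrow> real"
  assumes h: "h \<in> borel_measurable M"
    and osc: "\<And>x y. x \<in> space M \<Longrightarrow> y \<in> space M \<Longrightarrow> h x - h y \<le> c"
    and s: "s > 0"
  shows "(\<integral>\<^sup>+x. exp (s * (h x - expectation h)) \<partial>M) \<le> exp (s\<^sup>2 * c\<^sup>2 / 8)"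
proof -
  obtain x0 where x0: "x0 \<in> space M"
    using not_empty by blast
  define a where "a = (INF x\<in>space M. h x)"
  have bdd: "bdd_below (h ` space M)"
    using osc[OF x0] by (intro bdd_belowI2[of _ "h x0 - c"]) (simp add: algebra_simps)
  have "a \<le> h x" if "x \<in> space M" for x
    unfolding a_def using bdd that by (rule cINF_lower)
  moreover have "h x - c \<le> a" if "x \<in> space M" for x
    unfolding a_def using x0 osc[OF that] by (intro cINF_greatest) (auto simp: algebra_simps)
  ultimately interpret interval_bounded_random_variable M h a "a + c"
    by unfold_locales (use h in \<open>auto simp: algebra_simps\<close>)
  show ?thesis
    using Hoeffdings_lemma_nn_integral[OF s] by simp
qed

text \<open>The induction integrates out one coordinate \<open>i\<close>. The averaged function \<open>g\<close> inherits the bounded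
  differences in the remaining coordinates, and for fixed remaining coordinates the centred slice
  \<open>f - g\<close> oscillates by at most \<open>c i\<close>, so Hoeffding's lemma contributes the factor
  \<open>exp (s\<^sup>2 (c i)\<^sup>2 / 8)\<close>.\<close>

lemma nn_integral_exp_le_of_bounded_differences:
  fixes N :: "'i \<Rightarrow> 'a measure" and f :: "('i \<Rightarrow> 'a) \<Rightarrow> real"
  assumes "finite I" and N: "\<And>i. prob_space (N i)"
    and "f \<in> borel_measurable (PiM I N)"
    and "\<And>x. x \<in> space (PiM I N) \<Longrightarrow> \<bar>f x\<bar> \<le> B"
    and "\<And>i x y. i \<in> I \<Longrightarrow> x \<in> space (PiM I N) \<Longrightarrow> y \<in> space (N i) \<Longrightarrow> \<bar>f (x(i := y)) - f x\<bar> \<le> c i"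
    and s: "s > 0"
  shows "(\<integral>\<^sup>+x. exp (s * (f x - (LINT x|PiM I N. f x))) \<partial>PiM I N) \<le> exp (s\<^sup>2 * (\<Sum>i\<in>I. (c i)\<^sup>2) / 8)"
  using assms(1,3-5)
proof (induction I arbitrary: f rule: finite_induct)
  case empty
  show ?case
    by (simp add: PiM_empty nn_integral_count_space_finite lebesgue_integral_count_space_finite)
next
  case (insert i I)
  interpret Ni: prob_space "N i" by (rule N)
  interpret P: prob_space "PiM I N" by (rule prob_space_PiM) (rule N)
  interpret Q: prob_space "PiM (insert i I) N" by (rule prob_space_PiM) (rule N)
  interpret N: product_prob_space N
    by (rule product_prob_spaceI) (rule N)
  note f[measurable] = insert.prems(1)
  note bound = insert.prems(2)
  note diff = insert.prems(3)
  have upd: "x(i := y) \<in> space (PiM (insert i I) N)" if "x \<in> space (PiM I N)" "y \<in> space (N i)" for x y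
    using that insert.hyps by (auto simp: space_PiM PiE_def extensional_def)
  have f_pair[measurable]: "(\<lambda>(x, y). f (x(i := y))) \<in> borel_measurable (PiM I N \<Otimes>\<^sub>M N i)"
    using measurable_compose[OF measurable_add_dim f] by (simp add: case_prod_unfold)
  have f_slice: "(\<lambda>y. f (x(i := y))) \<in> borel_measurable (N i)" if "x \<in> space (PiM I N)" for x
    using measurable_compose[OF measurable_Pair1'[OF that] f_pair] by simp
  define g where "g x = (LINT y|N i. f (x(i := y)))" for x
  have g[measurable]: "g \<in> borel_measurable (PiM I N)"
    unfolding g_def by measurable
  have g_bound: "\<bar>g x\<bar> \<le> B" if "x \<in> space (PiM I N)" for x
    unfolding g_def using that by (intro Ni.abs_expectation_le f_slice bound upd)
  have g_diff: "\<bar>g (x(j := y)) - g x\<bar> \<le> c j"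
    if j: "j \<in> I" and x: "x \<in> space (PiM I N)" and y: "y \<in> space (N j)" for j x y
  proof -
    have xy: "x(j := y) \<in> space (PiM I N)"
      using j x y by (auto simp: space_PiM PiE_def extensional_def)
    have int: "integrable (N i) (\<lambda>z. f (x'(i := z)))" if "x' \<in> space (PiM I N)" for x'
      using that by (intro Ni.integrable_if_bounded[where B = B] f_slice bound upd)
    have "g (x(j := y)) - g x = (LINT z|N i. f (x(j := y, i := z)) - f (x(i := z)))"
      unfolding g_def using int[OF xy] int[OF x] by simp
    also have "\<bar>\<dots>\<bar> \<le> c j"
    proof (rule Ni.abs_expectation_le)
      show "(\<lambda>z. f (x(j := y, i := z)) - f (x(i := z))) \<in> borel_measurable (N i)"
        using f_slice[OF xy] f_slice[OF x] by simp
      fix z assume z: "z \<in> space (N i)"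
      have twist: "x(j := y, i := z) = x(i := z, j := y)"
        using j insert.hyps by (auto simp: fun_upd_twist)
      show "\<bar>f (x(j := y, i := z)) - f (x(i := z))\<bar> \<le> c j"
        unfolding twist using j by (intro diff upd x y z) auto
    qed
    finally show ?thesis .
  qed
  have E: "(LINT x|PiM (insert i I) N. f x) = (LINT x|PiM I N. g x)"
    unfolding g_def using insert.hyps
    by (intro N.product_integral_insert Q.integrable_if_bounded[where B = B] f bound)
  let ?E = "LINT x|PiM I N. g x"
  have "(\<integral>\<^sup>+x. exp (s * (f x - (LINT x|PiM (insert i I) N. f x))) \<partial>PiM (insert i I) N)
      = (\<integral>\<^sup>+x. (\<integral>\<^sup>+y. exp (s * (f (x(i := y)) - ?E)) \<partial>N i) \<partial>PiM I N)"
    unfolding E using insert.hyps by (intro N.product_nn_integral_insert) auto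
  also have "\<dots> \<le> (\<integral>\<^sup>+x. ennreal (exp (s * (g x - ?E))) * ennreal (exp (s\<^sup>2 * (c i)\<^sup>2 / 8)) \<partial>PiM I N)"
  proof (rule nn_integral_mono)
    fix x assume x: "x \<in> space (PiM I N)"
    have "(\<integral>\<^sup>+y. exp (s * (f (x(i := y)) - ?E)) \<partial>N i)
        = (\<integral>\<^sup>+y. ennreal (exp (s * (g x - ?E))) * ennreal (exp (s * (f (x(i := y)) - g x))) \<partial>N i)"
      by (intro nn_integral_cong) (simp add: algebra_simps flip: ennreal_mult exp_add)
    also have "\<dots> = ennreal (exp (s * (g x - ?E))) * (\<integral>\<^sup>+y. exp (s * (f (x(i := y)) - g x)) \<partial>N i)"
      using f_slice[OF x] by (intro nn_integral_cmult) auto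
    also have "(\<integral>\<^sup>+y. exp (s * (f (x(i := y)) - g x)) \<partial>N i) \<le> exp (s\<^sup>2 * (c i)\<^sup>2 / 8)"
      unfolding g_def
    proof (rule Ni.nn_integral_exp_le_of_oscillation[OF f_slice[OF x] _ s])
      fix y z assume yz: "y \<in> space (N i)" "z \<in> space (N i)"
      show "f (x(i := y)) - f (x(i := z)) \<le> c i"
        using abs_le_D1[OF diff[OF insertI1 upd[OF x yz(2)] yz(1)]] unfolding fun_upd_upd .
    qed
    finally show "(\<integral>\<^sup>+y. exp (s * (f (x(i := y)) - ?E)) \<partial>N i)
        \<le> ennreal (exp (s * (g x - ?E))) * ennreal (exp (s\<^sup>2 * (c i)\<^sup>2 / 8))"
      by (simp add: mult_left_mono)
  qed
  also have "\<dots> = (\<integral>\<^sup>+x. exp (s * (g x - ?E)) \<partial>PiM I N) * ennreal (exp (s\<^sup>2 * (c i)\<^sup>2 / 8))"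
    by (intro nn_integral_multc) auto
  also have "\<dots> \<le> ennreal (exp (s\<^sup>2 * (\<Sum>i\<in>I. (c i)\<^sup>2) / 8)) * ennreal (exp (s\<^sup>2 * (c i)\<^sup>2 / 8))"
    by (intro mult_right_mono insert.IH g g_bound g_diff) auto
  also have "\<dots> = exp (s\<^sup>2 * (\<Sum>i\<in>insert i I. (c i)\<^sup>2) / 8)"
    using insert.hyps by (simp add: algebra_simps add_divide_distrib flip: ennreal_mult exp_add)
  finally show ?case .
qed

theorem McDiarmid_inequality:
  fixes N :: "'i \<Rightarrow> 'a measure" and f :: "('i \<Rightarrow> 'a) \<Rightarrow> real"
  assumes I: "finite I" and N: "\<And>i. prob_space (N i)"
    and f: "f \<in> borel_measurable (PiM I N)"
    and bound: "\<And>x. x \<in> space (PiM I N) \<Longrightarrow> \<bar>f x\<bar> \<le> B"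
    and diff: "\<And>i x y. i \<in> I \<Longrightarrow> x \<in> space (PiM I N) \<Longrightarrow> y \<in> space (N i) \<Longrightarrow> \<bar>f (x(i := y)) - f x\<bar> \<le> c i"
    and t: "t > 0" and c: "(\<Sum>i\<in>I. (c i)\<^sup>2) > 0"
  shows "\<P>(x in PiM I N. f x - (LINT x|PiM I N. f x) \<ge> t) \<le> exp (- 2 * t\<^sup>2 / (\<Sum>i\<in>I. (c i)\<^sup>2))"
proof -
  interpret prob_space "PiM I N" by (rule prob_space_PiM) (rule N)
  let ?C = "\<Sum>i\<in>I. (c i)\<^sup>2" and ?E = "LINT x|PiM I N. f x"
  \<comment> \<open>the minimizer of the Chernoff exponent \<open>- s t + s\<^sup>2 C / 8\<close>\<close>
  define s where "s = 4 * t / ?C"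
  have s: "s > 0"
    using t c by (simp add: s_def)
  have "emeasure (PiM I N) {x \<in> space (PiM I N). f x - ?E \<ge> t}
      \<le> ennreal (exp (- s * t)) * (\<integral>\<^sup>+x. ennreal (exp (s * (f x - ?E))) * indicator (space (PiM I N)) x \<partial>PiM I N)"
    using s f by (intro Chernoff_ineq_nn_integral_ge) auto
  also have "(\<integral>\<^sup>+x. ennreal (exp (s * (f x - ?E))) * indicator (space (PiM I N)) x \<partial>PiM I N)
      = (\<integral>\<^sup>+x. exp (s * (f x - ?E)) \<partial>PiM I N)"
    by (intro nn_integral_cong) simp
  also have "\<dots> \<le> exp (s\<^sup>2 * ?C / 8)"
    using assms s by (intro nn_integral_exp_le_of_bounded_differences) auto
  finally have "emeasure (PiM I N) {x \<in> space (PiM I N). f x - ?E \<ge> t}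
      \<le> ennreal (exp (- s * t)) * ennreal (exp (s\<^sup>2 * ?C / 8))"
    by (simp add: mult_left_mono)
  also have "\<dots> = ennreal (exp (- s * t + s\<^sup>2 * ?C / 8))"
    by (simp flip: ennreal_mult exp_add)
  also have "- s * t + s\<^sup>2 * ?C / 8 = - 2 * t\<^sup>2 / ?C"
    using c by (simp add: s_def power2_eq_square field_simps)
  finally show ?thesis
    by (simp add: emeasure_eq_measure)
qed

section \<open>Rademacher averages as finite averages over sign vectors\<close>

lemma sum_lessThan_add:
  fixes h :: "nat \<Rightarrow> 'a::comm_monoid_add"
  shows "(\<Sum>i<m + n. h i) = (\<Sum>i<m. h i) + (\<Sum>i<n. h (m + i))"
  by (induction n) (auto simp: add.assoc)

lemma rademacher_sup_cong:
  assumes "\<And>i. i < k \<Longrightarrow> \<sigma> i = \<sigma>' i" and "\<And>i. i < k \<Longrightarrow> z i = z' i"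
  shows "rademacher_sup k G \<sigma> z = rademacher_sup k G \<sigma>' z'"
proof -
  have "(\<Sum>i<k. \<sigma> i * g (z i)) = (\<Sum>i<k. \<sigma>' i * g (z' i))" for g
    using assms by (intro sum.cong) auto
  then show ?thesis
    by (simp add: rademacher_sup_def)
qed

lemma rademacher_sup_permute:
  assumes "bij_betw p {..<k} {..<k}"
  shows "rademacher_sup k G (\<lambda>i. \<sigma> (p i)) (\<lambda>i. z (p i)) = rademacher_sup k G \<sigma> z"
  unfolding rademacher_sup_def
  by (intro SUP_cong refl arg_cong[where f = abs] sum.reindex_bij_betw[OF assms, where g = "\<lambda>i. \<sigma> i * _ (z i)"])

abbreviation sign_vectors :: "nat \<Rightarrow> (nat \<Rightarrow> real) set" where
  "sign_vectors n \<equiv> PiE_dflt {..<n} 0 (\<lambda>_. {-1, 1})"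

abbreviation random_signs :: "nat \<Rightarrow> (nat \<Rightarrow> real) pmf" where
  "random_signs n \<equiv> Pi_pmf {..<n} 0 (\<lambda>_. pmf_of_set {-1, 1})"

lemma finite_sign_vectors: "finite (sign_vectors n)"
  by (rule finite_PiE_dflt) auto

lemma sign_vectorsD: "\<sigma> \<in> sign_vectors n \<Longrightarrow> i < n \<Longrightarrow> \<sigma> i \<in> {-1, 1}"
  by (auto simp: PiE_dflt_def)

lemma set_random_signs: "set_pmf (random_signs n) = sign_vectors n"
  by (simp add: set_Pi_pmf o_def)

text \<open>As a finite convex combination, the Rademacher average inherits measurability, integrability and bounded
  differences from \<open>rademacher_sup\<close> for each fixed sign vector.\<close>

lemma rademacher_avg_eq_sum:
  "rademacher_avg n z G =
     (\<Sum>\<sigma>\<in>sign_vectors n. pmf (random_signs n) \<sigma> * ((1 / real n) * rademacher_sup n G \<sigma> z))"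
  unfolding rademacher_avg_def
  by (subst integral_measure_pmf[OF finite_sign_vectors]) (auto simp: set_random_signs)

lemma sum_pmf_random_signs: "(\<Sum>\<sigma>\<in>sign_vectors n. pmf (random_signs n) \<sigma>) = 1"
  by (rule sum_pmf_eq_1) (simp_all add: finite_sign_vectors set_random_signs)

lemma abs_sum_pmf_random_signs_le:
  assumes "\<And>\<sigma>. \<sigma> \<in> sign_vectors n \<Longrightarrow> \<bar>h \<sigma>\<bar> \<le> c"
  shows "\<bar>\<Sum>\<sigma>\<in>sign_vectors n. pmf (random_signs n) \<sigma> * h \<sigma>\<bar> \<le> c"
proof -
  have "\<bar>\<Sum>\<sigma>\<in>sign_vectors n. pmf (random_signs n) \<sigma> * h \<sigma>\<bar>
      \<le> (\<Sum>\<sigma>\<in>sign_vectors n. pmf (random_signs n) \<sigma> * c)"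
    using assms by (intro order.trans[OF sum_abs] sum_mono) (auto simp: abs_mult intro: mult_left_mono)
  then show ?thesis
    by (simp add: sum_pmf_random_signs flip: sum_distrib_right)
qed

section \<open>Bounded classes with measurable signed suprema\<close>

text \<open>The last assumption concerns every sample size: size \<open>n\<close> serves the Rademacher average of the
  data, size \<open>2 * n\<close> the comparison of the data with a ghost sample.\<close>

locale bounded_function_class = prob_space D for D :: "'z measure" +
  fixes G :: "('z \<Rightarrow> real) set" and M :: real
  assumes nonempty: "G \<noteq> {}"
    and measurable_class: "\<And>g. g \<in> G \<Longrightarrow> g \<in> borel_measurable D"
    and class_range: "\<And>g z. g \<in> G \<Longrightarrow> z \<in> space D \<Longrightarrow> g z \<in> {0..M}"
    and measurable_rademacher_sup: "\<And>k \<sigma>. (\<And>i. i < k \<Longrightarrow> \<sigma> i \<in> {-1, 1}) \<Longrightarrow>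
           rademacher_sup k G \<sigma> \<in> borel_measurable (Pi\<^sub>M {..<k} (\<lambda>_. D))"
begin

abbreviation samples :: "nat \<Rightarrow> (nat \<Rightarrow> 'z) measure" where
  "samples k \<equiv> Pi\<^sub>M {..<k} (\<lambda>_. D)"

lemma prob_space_PiM_D: "prob_space (Pi\<^sub>M I (\<lambda>_. D))"
  by (intro prob_space_PiM prob_space_axioms)

lemma M_nonneg: "0 \<le> M"
  using nonempty not_empty class_range by fastforce

lemma abs_class_le: "g \<in> G \<Longrightarrow> z \<in> space D \<Longrightarrow> \<bar>g z\<bar> \<le> M"
  using class_range[of g z] by auto

lemma abs_class_diff_le: "g \<in> G \<Longrightarrow> y \<in> space D \<Longrightarrow> z \<in> space D \<Longrightarrow> \<bar>g y - g z\<bar> \<le> M"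
  using class_range[of g y] class_range[of g z] by auto

context
  fixes k :: nat and \<sigma> :: "nat \<Rightarrow> real"
  assumes signs: "\<And>i. i < k \<Longrightarrow> \<sigma> i \<in> {-1, 1}"
begin

lemma abs_sign: "i < k \<Longrightarrow> \<bar>\<sigma> i\<bar> = 1"
  using signs[of i] by auto

lemma abs_signed_sum_le:
  assumes "g \<in> G" "\<And>i. i < k \<Longrightarrow> z i \<in> space D"
  shows "\<bar>\<Sum>i<k. \<sigma> i * g (z i)\<bar> \<le> real k * M"
proof -
  have "\<bar>\<Sum>i<k. \<sigma> i * g (z i)\<bar> \<le> (\<Sum>i<k. M)"
    using assms abs_class_le[of g] abs_sign
    by (intro order.trans[OF sum_abs] sum_mono) (auto simp: abs_mult)
  then show ?thesis by simp
qed

lemma rademacher_sup_upper: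
  assumes "g \<in> G" "\<And>i. i < k \<Longrightarrow> z i \<in> space D"
  shows "\<bar>\<Sum>i<k. \<sigma> i * g (z i)\<bar> \<le> rademacher_sup k G \<sigma> z"
  unfolding rademacher_sup_def
  using assms abs_signed_sum_le[of _ z] by (intro cSUP_upper bdd_aboveI2[where M = "real k * M"]) auto

lemma rademacher_sup_least:
  assumes "\<And>g. g \<in> G \<Longrightarrow> \<bar>\<Sum>i<k. \<sigma> i * g (z i)\<bar> \<le> c"
  shows "rademacher_sup k G \<sigma> z \<le> c"
  unfolding rademacher_sup_def using nonempty assms by (rule cSUP_least)

lemma rademacher_sup_bounds:
  assumes "\<And>i. i < k \<Longrightarrow> z i \<in> space D"
  shows "rademacher_sup k G \<sigma> z \<in> {0..real k * M}"
proof -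
  obtain g where "g \<in> G"
    using nonempty by blast
  then have "0 \<le> rademacher_sup k G \<sigma> z"
    using assms by (intro order.trans[OF abs_ge_zero rademacher_sup_upper])
  then show ?thesis
    using rademacher_sup_least[of z] abs_signed_sum_le[of _ z] assms by auto
qed

lemma rademacher_sup_update_le:
  assumes z: "\<And>i. i < k \<Longrightarrow> z i \<in> space D" and y: "y \<in> space D"
  shows "rademacher_sup k G \<sigma> (z(j := y)) \<le> rademacher_sup k G \<sigma> z + M"
proof (rule rademacher_sup_least)
  fix g assume g: "g \<in> G"
  have "(\<Sum>i<k. \<sigma> i * g ((z(j := y)) i)) - (\<Sum>i<k. \<sigma> i * g (z i))
      = (\<Sum>i<k. if i = j then \<sigma> j * (g y - g (z j)) else 0)"
    unfolding sum_subtractf[symmetric] by (intro sum.cong) (auto simp: algebra_simps)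
  also have "\<bar>\<dots>\<bar> \<le> M"
    using abs_class_diff_le[OF g y z[of j]] abs_sign[of j] M_nonneg by (auto simp: abs_mult)
  finally show "\<bar>\<Sum>i<k. \<sigma> i * g ((z(j := y)) i)\<bar> \<le> rademacher_sup k G \<sigma> z + M"
    using rademacher_sup_upper[of g z] g z by fastforce
qed

lemma abs_rademacher_sup_update_le:
  assumes z: "\<And>i. i < k \<Longrightarrow> z i \<in> space D" and y: "y \<in> space D" and j: "j < k"
  shows "\<bar>rademacher_sup k G \<sigma> (z(j := y)) - rademacher_sup k G \<sigma> z\<bar> \<le> M"
proof -
  have "rademacher_sup k G \<sigma> ((z(j := y))(j := z j)) \<le> rademacher_sup k G \<sigma> (z(j := y)) + M"
    using z y j by (intro rademacher_sup_update_le) auto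
  moreover have "rademacher_sup k G \<sigma> (z(j := y)) \<le> rademacher_sup k G \<sigma> z + M"
    using z y by (intro rademacher_sup_update_le)
  ultimately show ?thesis by simp
qed

lemma integrable_rademacher_sup: "integrable (samples k) (rademacher_sup k G \<sigma>)"
proof -
  interpret P: prob_space "samples k" by (rule prob_space_PiM_D)
  show ?thesis
    using rademacher_sup_bounds
    by (intro P.integrable_if_bounded[where B = "real k * M"] measurable_rademacher_sup signs)
      (auto simp: space_PiM PiE_iff)
qed

end

lemma rademacher_avg_bounds:
  assumes "n \<ge> 1" and z: "\<And>i. i < n \<Longrightarrow> z i \<in> space D"
  shows "rademacher_avg n z G \<in> {0..M}"
proof -
  have *: "rademacher_sup n G \<sigma> z \<in> {0..real n * M}" if "\<sigma> \<in> sign_vectors n" for \<sigma>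
    using sign_vectorsD[OF that] z by (rule rademacher_sup_bounds)
  have "0 \<le> rademacher_avg n z G"
    unfolding rademacher_avg_eq_sum using * by (intro sum_nonneg) auto
  moreover have "\<bar>rademacher_avg n z G\<bar> \<le> M"
    unfolding rademacher_avg_eq_sum
    using * \<open>n \<ge> 1\<close> by (intro abs_sum_pmf_random_signs_le) (auto simp: field_simps)
  ultimately show ?thesis by simp
qed

lemma abs_rademacher_avg_update_le:
  assumes "n \<ge> 1" and z: "\<And>i. i < n \<Longrightarrow> z i \<in> space D" and y: "y \<in> space D" and j: "j < n"
  shows "\<bar>rademacher_avg n (z(j := y)) G - rademacher_avg n z G\<bar> \<le> M / real n"
proof -
  have "rademacher_avg n (z(j := y)) G - rademacher_avg n z G
      = (\<Sum>\<sigma>\<in>sign_vectors n. pmf (random_signs n) \<sigma> *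
          ((1 / real n) * (rademacher_sup n G \<sigma> (z(j := y)) - rademacher_sup n G \<sigma> z)))"
    unfolding rademacher_avg_eq_sum by (simp add: sum_subtractf[symmetric] algebra_simps diff_divide_distrib)
  also have "\<bar>\<dots>\<bar> \<le> M / real n"
  proof (rule abs_sum_pmf_random_signs_le)
    fix \<sigma> assume "\<sigma> \<in> sign_vectors n"
    then have "\<bar>rademacher_sup n G \<sigma> (z(j := y)) - rademacher_sup n G \<sigma> z\<bar> \<le> M"
      using sign_vectorsD z y j by (intro abs_rademacher_sup_update_le)
    then show "\<bar>(1 / real n) * (rademacher_sup n G \<sigma> (z(j := y)) - rademacher_sup n G \<sigma> z)\<bar> \<le> M / real n"
      by (simp add: divide_right_mono)
  qed
  finally show ?thesis .
qed

lemma measurable_rademacher_avg: "(\<lambda>z. rademacher_avg n z G) \<in> borel_measurable (samples n)"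
  unfolding rademacher_avg_eq_sum
  by (intro borel_measurable_sum borel_measurable_times borel_measurable_const
        measurable_rademacher_sup sign_vectorsD)

lemma expectation_rademacher_avg:
  "(LINT z|samples n. rademacher_avg n z G) =
     (\<Sum>\<sigma>\<in>sign_vectors n. pmf (random_signs n) \<sigma> *
        ((1 / real n) * (LINT z|samples n. rademacher_sup n G \<sigma> z)))"
proof -
  have "integrable (samples n) (rademacher_sup n G \<sigma>)" if "\<sigma> \<in> sign_vectors n" for \<sigma>
    using sign_vectorsD[OF that] by (rule integrable_rademacher_sup)
  then show ?thesis
    unfolding rademacher_avg_eq_sum by (subst Bochner_Integration.integral_sum) auto
qed

text \<open>Independent identically distributed points may be selected and relabelled by an injection: a permutation
  of all the points gives exchangeability, an embedding gives marginals.\<close>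

lemma integral_reindex:
  assumes f: "inj_on f {..<m}" "f \<in> {..<m} \<rightarrow> {..<k}" and h: "h \<in> borel_measurable (samples m)"
  shows "(LINT w|samples k. h (\<lambda>i\<in>{..<m}. w (f i))) = (LINT w|samples m. (h w :: real))"
proof -
  have "distr (samples k) (samples m) (\<lambda>w. \<lambda>i\<in>{..<m}. w (f i)) = samples m"
    using f prob_space_axioms by (intro distr_PiM_reindex)
  moreover have "(\<lambda>w. \<lambda>i\<in>{..<m}. w (f i)) \<in> measurable (samples k) (samples m)"
    using f by (intro measurable_restrict measurable_component_singleton) auto
  ultimately show ?thesis
    using integral_distr[OF _ h, of "\<lambda>w. \<lambda>i\<in>{..<m}. w (f i)" "samples k"] by simp
qed

section \<open>Symmetrization with a ghost sample\<close>

text \<open>With these signs a signed sum over \<open>2 * n\<close> points is the sum over the second half minus the sum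
  over the first, so that the supremum of differences between two samples is an instance of
  \<open>rademacher_sup\<close>, hence measurable.\<close>

definition ghost_signs :: "nat \<Rightarrow> nat \<Rightarrow> real" where
  "ghost_signs n i = (if i < n then -1 else 1)"

lemma ghost_signs: "ghost_signs n i \<in> {-1, 1}"
  by (simp add: ghost_signs_def)

lemma sum_ghost_signs:
  "(\<Sum>i<2 * n. ghost_signs n i * h i) = (\<Sum>i<n. h (n + i)) - (\<Sum>i<n. h i)"
  using sum_lessThan_add[of "\<lambda>i. ghost_signs n i * h i" n n]
  by (simp add: ghost_signs_def mult_2 sum_negf)

text \<open>Swapping the points \<open>i\<close> and \<open>n + i\<close> for all \<open>i\<close> with \<open>\<sigma> i = -1\<close> preserves the joint distribution of
  the two samples and turns the ghost signs into \<open>(-\<sigma>, \<sigma>)\<close>. The triangle inequality then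
  separates the two halves, and the absolute value inside \<open>rademacher_sup\<close> absorbs the minus sign of the
  first one. The bound thus holds for each \<open>\<sigma>\<close>, not only on average.\<close>

lemma expectation_ghost_signs_le:
  assumes \<sigma>: "\<And>i. i < n \<Longrightarrow> \<sigma> i \<in> {-1, 1}"
  shows "(LINT w|samples (2 * n). rademacher_sup (2 * n) G (ghost_signs n) w)
      \<le> 2 * (LINT z|samples n. rademacher_sup n G \<sigma> z)"
proof -
  \<comment> \<open>the swap of the two halves at the negative signs; it is an involution of \<open>{..<2 * n}\<close>\<close>
  define p where "p i = (if i < n then if \<sigma> i = 1 then i else n + i
                         else if \<sigma> (i - n) = 1 then i else i - n)" for i
  have p_in: "p i \<in> {..<2 * n}" if "i \<in> {..<2 * n}" for i
    using that by (auto simp: p_def)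
  have p_p: "p (p i) = i" if "i \<in> {..<2 * n}" for i
    using that by (auto simp: p_def)
  have p: "bij_betw p {..<2 * n} {..<2 * n}"
    using p_in p_p by (intro bij_betw_byWitness[where f' = p]) auto
  define \<tau> where "\<tau> i = ghost_signs n (p i)" for i
  have \<tau>: "\<tau> i \<in> {-1, 1}" for i
    unfolding \<tau>_def by (rule ghost_signs)
  have \<tau>_low: "\<tau> i = - \<sigma> i" if "i < n" for i
    using that \<sigma>[OF that] by (auto simp: \<tau>_def p_def ghost_signs_def)
  have \<tau>_high: "\<tau> (n + i) = \<sigma> i" if "i < n" for i
    using that \<sigma>[OF that] by (auto simp: \<tau>_def p_def ghost_signs_def)
  interpret P: prob_space "samples (2 * n)" by (rule prob_space_PiM_D)
  have int: "integrable (samples (2 * n)) (\<lambda>w. rademacher_sup n G \<sigma> (\<lambda>i\<in>{..<n}. w (f i)))"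
    if "f \<in> {..<n} \<rightarrow> {..<2 * n}" for f
  proof (rule P.integrable_if_bounded)
    show "(\<lambda>w. rademacher_sup n G \<sigma> (\<lambda>i\<in>{..<n}. w (f i))) \<in> borel_measurable (samples (2 * n))"
      using that
      by (intro measurable_compose[OF measurable_restrict measurable_rademacher_sup[OF \<sigma>]]
            measurable_component_singleton) auto
    show "\<bar>rademacher_sup n G \<sigma> (\<lambda>i\<in>{..<n}. w (f i))\<bar> \<le> real n * M" if "w \<in> space (samples (2 * n))" for w
      using rademacher_sup_bounds[of n \<sigma> "\<lambda>i\<in>{..<n}. w (f i)"] \<sigma> that \<open>f \<in> _\<close>
      by (auto simp: space_PiM PiE_iff Pi_iff)
  qed
  have "(LINT w|samples (2 * n). rademacher_sup (2 * n) G (ghost_signs n) w)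
      = (LINT w|samples (2 * n). rademacher_sup (2 * n) G \<tau> (\<lambda>i\<in>{..<2 * n}. w (p i)))"
  proof (intro Bochner_Integration.integral_cong refl)
    fix w
    have "rademacher_sup (2 * n) G \<tau> (\<lambda>i\<in>{..<2 * n}. w (p i))
        = rademacher_sup (2 * n) G (\<lambda>i. ghost_signs n (p i)) (\<lambda>i. w (p i))"
      by (intro rademacher_sup_cong) (auto simp: \<tau>_def)
    then show "rademacher_sup (2 * n) G (ghost_signs n) w
        = rademacher_sup (2 * n) G \<tau> (\<lambda>i\<in>{..<2 * n}. w (p i))"
      using rademacher_sup_permute[OF p, of G "ghost_signs n" w] by (simp only:)
  qed
  also have "\<dots> = (LINT w|samples (2 * n). rademacher_sup (2 * n) G \<tau> w)"
    using p by (intro integral_reindex measurable_rademacher_sup \<tau>) (auto simp: bij_betw_def)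
  also have "\<dots> \<le> (LINT w|samples (2 * n). rademacher_sup n G \<sigma> (\<lambda>i\<in>{..<n}. w i)
                                       + rademacher_sup n G \<sigma> (\<lambda>i\<in>{..<n}. w (n + i)))"
  proof (rule integral_mono)
    show "integrable (samples (2 * n)) (rademacher_sup (2 * n) G \<tau>)"
      by (rule integrable_rademacher_sup) (rule \<tau>)
    show "integrable (samples (2 * n)) (\<lambda>w. rademacher_sup n G \<sigma> (\<lambda>i\<in>{..<n}. w i)
                                       + rademacher_sup n G \<sigma> (\<lambda>i\<in>{..<n}. w (n + i)))"
      by (intro Bochner_Integration.integrable_add int) auto
    fix w assume w: "w \<in> space (samples (2 * n))"
    then have w1: "\<And>i. i < n \<Longrightarrow> (\<lambda>i\<in>{..<n}. w i) i \<in> space D"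
      and w2: "\<And>i. i < n \<Longrightarrow> (\<lambda>i\<in>{..<n}. w (n + i)) i \<in> space D"
      by (auto simp: space_PiM PiE_iff)
    show "rademacher_sup (2 * n) G \<tau> w
        \<le> rademacher_sup n G \<sigma> (\<lambda>i\<in>{..<n}. w i) + rademacher_sup n G \<sigma> (\<lambda>i\<in>{..<n}. w (n + i))"
    proof (rule rademacher_sup_least)
      fix g assume g: "g \<in> G"
      have "(\<Sum>i<2 * n. \<tau> i * g (w i)) = (\<Sum>i<n. \<sigma> i * g (w (n + i))) - (\<Sum>i<n. \<sigma> i * g (w i))"
        using sum_lessThan_add[of "\<lambda>i. \<tau> i * g (w i)" n n] \<tau>_low \<tau>_high
        by (simp add: mult_2 sum_negf)
      moreover have "\<bar>\<Sum>i<n. \<sigma> i * g ((\<lambda>i\<in>{..<n}. w i) i)\<bar> \<le> rademacher_sup n G \<sigma> (\<lambda>i\<in>{..<n}. w i)"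
        by (intro rademacher_sup_upper \<sigma> g w1)
      moreover have "\<bar>\<Sum>i<n. \<sigma> i * g ((\<lambda>i\<in>{..<n}. w (n + i)) i)\<bar> \<le> rademacher_sup n G \<sigma> (\<lambda>i\<in>{..<n}. w (n + i))"
        by (intro rademacher_sup_upper \<sigma> g w2)
      ultimately show "\<bar>\<Sum>i<2 * n. \<tau> i * g (w i)\<bar>
          \<le> rademacher_sup n G \<sigma> (\<lambda>i\<in>{..<n}. w i) + rademacher_sup n G \<sigma> (\<lambda>i\<in>{..<n}. w (n + i))"
        by simp
    qed (rule \<tau>)
  qed
  also have "\<dots> = 2 * (LINT z|samples n. rademacher_sup n G \<sigma> z)"
  proof -
    have half: "(LINT w|samples (2 * n). rademacher_sup n G \<sigma> (\<lambda>i\<in>{..<n}. w (f i)))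
        = (LINT z|samples n. rademacher_sup n G \<sigma> z)"
      if "inj_on f {..<n}" "f \<in> {..<n} \<rightarrow> {..<2 * n}" for f
      using that by (intro integral_reindex measurable_rademacher_sup \<sigma>)
    show ?thesis
      using int[of "\<lambda>i. i"] int[of "\<lambda>i. n + i"] half[of "\<lambda>i. i"] half[of "\<lambda>i. n + i"]
      by (simp add: inj_on_def)
  qed
  finally show ?thesis .
qed

text \<open>The ghost sample is indexed by \<open>{n..<2 * n}\<close>, disjoint from the indices of the data, so that Fubini for
  product measures applies to the joint sample as it stands.\<close>

definition ghost_merge :: "nat \<Rightarrow> (nat \<Rightarrow> 'z) \<Rightarrow> (nat \<Rightarrow> 'z) \<Rightarrow> nat \<Rightarrow> 'z" where
  "ghost_merge n z z' = merge {..<n} {n..<2 * n} (z, z')"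

text \<open>A measurable stand-in for the supremum over the class of the expectation minus the empirical mean.\<close>

definition ghost_deviation :: "nat \<Rightarrow> (nat \<Rightarrow> 'z) \<Rightarrow> real" where
  "ghost_deviation n z = (1 / real n) *
     (LINT z'|Pi\<^sub>M {n..<2 * n} (\<lambda>_. D). rademacher_sup (2 * n) G (ghost_signs n) (ghost_merge n z z'))"

lemma ghost_merge_low: "i < n \<Longrightarrow> ghost_merge n z z' i = z i"
  by (simp add: ghost_merge_def merge_def)

lemma ghost_merge_high: "i < n \<Longrightarrow> ghost_merge n z z' (n + i) = z' (n + i)"
  by (simp add: ghost_merge_def merge_def)

lemma ghost_merge_update: "j < n \<Longrightarrow> ghost_merge n (z(j := y)) z' = (ghost_merge n z z')(j := y)"
  by (auto simp: ghost_merge_def merge_def fun_eq_iff)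

lemma ghost_merge_in_space:
  assumes "z \<in> space (samples n)" "z' \<in> space (Pi\<^sub>M {n..<2 * n} (\<lambda>_. D))" "i < 2 * n"
  shows "ghost_merge n z z' i \<in> space D"
  using assms by (auto simp: ghost_merge_def merge_def space_PiM PiE_iff)

lemma measurable_ghost_sup:
  "(\<lambda>(z, z'). rademacher_sup (2 * n) G (ghost_signs n) (ghost_merge n z z'))
     \<in> borel_measurable (samples n \<Otimes>\<^sub>M Pi\<^sub>M {n..<2 * n} (\<lambda>_. D))"
proof -
  have "{..<n} \<union> {n..<2 * n} = {..<2 * n}"
    by auto
  then have "merge {..<n} {n..<2 * n} \<in> measurable (samples n \<Otimes>\<^sub>M Pi\<^sub>M {n..<2 * n} (\<lambda>_. D)) (samples (2 * n))"
    using measurable_merge[of "{..<n}" "{n..<2 * n}" "\<lambda>_. D"] by simp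
  from measurable_compose[OF this measurable_rademacher_sup[OF ghost_signs]]
  show ?thesis
    by (simp add: ghost_merge_def case_prod_unfold)
qed

lemma measurable_ghost_sup_slice:
  assumes "z \<in> space (samples n)"
  shows "(\<lambda>z'. rademacher_sup (2 * n) G (ghost_signs n) (ghost_merge n z z'))
     \<in> borel_measurable (Pi\<^sub>M {n..<2 * n} (\<lambda>_. D))"
  using measurable_compose[OF measurable_Pair1'[OF assms] measurable_ghost_sup] by simp

lemma abs_ghost_sup_le:
  assumes "z \<in> space (samples n)" "z' \<in> space (Pi\<^sub>M {n..<2 * n} (\<lambda>_. D))"
  shows "\<bar>rademacher_sup (2 * n) G (ghost_signs n) (ghost_merge n z z')\<bar> \<le> real (2 * n) * M"
  using rademacher_sup_bounds[of "2 * n" "ghost_signs n" "ghost_merge n z z'"]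
    ghost_signs ghost_merge_in_space[OF assms] by auto

lemma integrable_ghost_sup:
  assumes "z \<in> space (samples n)"
  shows "integrable (Pi\<^sub>M {n..<2 * n} (\<lambda>_. D))
           (\<lambda>z'. rademacher_sup (2 * n) G (ghost_signs n) (ghost_merge n z z'))"
proof -
  interpret P: prob_space "Pi\<^sub>M {n..<2 * n} (\<lambda>_. D)" by (rule prob_space_PiM_D)
  show ?thesis
    using measurable_ghost_sup_slice[OF assms] abs_ghost_sup_le[OF assms] by (rule P.integrable_if_bounded)
qed

lemma measurable_ghost_deviation: "ghost_deviation n \<in> borel_measurable (samples n)"
proof -
  interpret P: prob_space "Pi\<^sub>M {n..<2 * n} (\<lambda>_. D)" by (rule prob_space_PiM_D)
  show ?thesis
    unfolding ghost_deviation_def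
    using P.borel_measurable_lebesgue_integral[OF measurable_ghost_sup] by simp
qed

lemma abs_ghost_deviation_le:
  assumes "n \<ge> 1" and z: "z \<in> space (samples n)"
  shows "\<bar>ghost_deviation n z\<bar> \<le> 2 * M"
proof -
  interpret P: prob_space "Pi\<^sub>M {n..<2 * n} (\<lambda>_. D)" by (rule prob_space_PiM_D)
  have "\<bar>LINT z'|Pi\<^sub>M {n..<2 * n} (\<lambda>_. D). rademacher_sup (2 * n) G (ghost_signs n) (ghost_merge n z z')\<bar>
      \<le> real (2 * n) * M"
    using measurable_ghost_sup_slice[OF z] abs_ghost_sup_le[OF z] by (rule P.abs_expectation_le)
  then show ?thesis
    using \<open>n \<ge> 1\<close> by (simp add: ghost_deviation_def abs_mult field_simps)
qed

lemma abs_ghost_deviation_update_le: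
  assumes "n \<ge> 1" and z: "z \<in> space (samples n)" and y: "y \<in> space D" and j: "j < n"
  shows "\<bar>ghost_deviation n (z(j := y)) - ghost_deviation n z\<bar> \<le> M / real n"
proof -
  interpret P: prob_space "Pi\<^sub>M {n..<2 * n} (\<lambda>_. D)" by (rule prob_space_PiM_D)
  let ?R = "\<lambda>z z'. rademacher_sup (2 * n) G (ghost_signs n) (ghost_merge n z z')"
  have zy: "z(j := y) \<in> space (samples n)"
    using z y j by (auto simp: space_PiM PiE_def extensional_def)
  have "ghost_deviation n (z(j := y)) - ghost_deviation n z
      = (1 / real n) * (LINT z'|Pi\<^sub>M {n..<2 * n} (\<lambda>_. D). ?R (z(j := y)) z' - ?R z z')"
    unfolding ghost_deviation_def using integrable_ghost_sup[OF zy] integrable_ghost_sup[OF z]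
    by (simp add: diff_divide_distrib)
  moreover have "\<bar>LINT z'|Pi\<^sub>M {n..<2 * n} (\<lambda>_. D). ?R (z(j := y)) z' - ?R z z'\<bar> \<le> M"
  proof (rule P.abs_expectation_le)
    show "(\<lambda>z'. ?R (z(j := y)) z' - ?R z z') \<in> borel_measurable (Pi\<^sub>M {n..<2 * n} (\<lambda>_. D))"
      using measurable_ghost_sup_slice[OF zy] measurable_ghost_sup_slice[OF z] by simp
    fix z' assume "z' \<in> space (Pi\<^sub>M {n..<2 * n} (\<lambda>_. D))"
    then show "\<bar>?R (z(j := y)) z' - ?R z z'\<bar> \<le> M"
      unfolding ghost_merge_update[OF j] using z y j
      by (intro abs_rademacher_sup_update_le ghost_signs ghost_merge_in_space) auto
  qed
  ultimately show ?thesis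
    by (simp add: abs_mult divide_right_mono)
qed

lemma expectation_ghost_deviation_le:
  assumes "n \<ge> 1"
  shows "(LINT z|samples n. ghost_deviation n z) \<le> 2 * (LINT z|samples n. rademacher_avg n z G)"
proof -
  interpret N: product_prob_space "\<lambda>_::nat. D"
    by (rule product_prob_spaceI) (rule prob_space_axioms)
  let ?R = "rademacher_sup (2 * n) G (ghost_signs n)"
  have un: "{..<n} \<union> {n..<2 * n} = {..<2 * n}"
    by auto
  have "(LINT w|samples (2 * n). ?R w)
      = (LINT z|samples n. LINT z'|Pi\<^sub>M {n..<2 * n} (\<lambda>_. D). ?R (ghost_merge n z z'))"
    using N.product_integral_fold[of "{..<n}" "{n..<2 * n}" ?R]
      integrable_rademacher_sup[of "2 * n" "ghost_signs n"] ghost_signs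
    unfolding un ghost_merge_def by fastforce
  then have E: "(LINT z|samples n. ghost_deviation n z) = (1 / real n) * (LINT w|samples (2 * n). ?R w)"
    by (simp add: ghost_deviation_def)
  have "(1 / real n) * (LINT w|samples (2 * n). ?R w)
      = (\<Sum>\<sigma>\<in>sign_vectors n. pmf (random_signs n) \<sigma> * ((1 / real n) * (LINT w|samples (2 * n). ?R w)))"
    unfolding sum_distrib_right[symmetric] sum_pmf_random_signs by simp
  also have "\<dots> \<le> (\<Sum>\<sigma>\<in>sign_vectors n. pmf (random_signs n) \<sigma> *
        ((1 / real n) * (2 * (LINT z|samples n. rademacher_sup n G \<sigma> z))))"
    using sign_vectorsD by (intro sum_mono mult_left_mono expectation_ghost_signs_le) auto
  also have "\<dots> = 2 * (LINT z|samples n. rademacher_avg n z G)"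
    unfolding expectation_rademacher_avg sum_distrib_left by (intro sum.cong) (auto simp: algebra_simps)
  finally show ?thesis
    unfolding E .
qed

text \<open>Jensen's inequality: the expectation of \<open>g\<close> is the expected empirical mean of \<open>g\<close> on the ghost sample, and for
  each ghost sample the difference of the two empirical means is at most the supremum.\<close>

lemma ghost_deviation_ge:
  assumes n: "n \<ge> 1" and z: "z \<in> space (samples n)" and g: "g \<in> G"
  shows "expectation g - (1 / real n) * (\<Sum>i<n. g (z i)) \<le> ghost_deviation n z"
proof -
  let ?P = "Pi\<^sub>M {n..<2 * n} (\<lambda>_. D)"
  interpret P: prob_space ?P by (rule prob_space_PiM_D)
  have comp: "integrable ?P (\<lambda>z'. g (z' (n + i)))" "(LINT z'|?P. g (z' (n + i))) = expectation g"
    if "i < n" for i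
  proof -
    have m: "(\<lambda>z'. z' (n + i)) \<in> measurable ?P D"
      using that by (intro measurable_component_singleton) auto
    have d: "distr ?P D (\<lambda>z'. z' (n + i)) = D"
      using that prob_space_axioms distr_PiM_component[of "{n..<2 * n}" "\<lambda>_. D" "n + i"] by simp
    show "(LINT z'|?P. g (z' (n + i))) = expectation g"
      using integral_distr[OF m measurable_class[OF g]] d by simp
    show "integrable ?P (\<lambda>z'. g (z' (n + i)))"
      using integrable_distr[OF m, of g] integrable_if_bounded[OF measurable_class[OF g] abs_class_le[OF g]] d
      by simp
  qed
  have "real n * expectation g - (\<Sum>i<n. g (z i))
      = (LINT z'|?P. (\<Sum>i<n. g (z' (n + i))) - (\<Sum>i<n. g (z i)))"
    using comp by (subst Bochner_Integration.integral_diff)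
      (auto simp: P.prob_space Bochner_Integration.integral_sum)
  also have "\<dots> \<le> (LINT z'|?P. rademacher_sup (2 * n) G (ghost_signs n) (ghost_merge n z z'))"
  proof (rule integral_mono)
    show "integrable ?P (\<lambda>z'. (\<Sum>i<n. g (z' (n + i))) - (\<Sum>i<n. g (z i)))"
      using comp by (intro Bochner_Integration.integrable_diff Bochner_Integration.integrable_sum) auto
    fix z' assume z': "z' \<in> space ?P"
    have "(\<Sum>i<n. g (z' (n + i))) - (\<Sum>i<n. g (z i))
        = (\<Sum>i<2 * n. ghost_signs n i * g (ghost_merge n z z' i))"
      by (simp add: sum_ghost_signs ghost_merge_low ghost_merge_high)
    also have "\<dots> \<le> rademacher_sup (2 * n) G (ghost_signs n) (ghost_merge n z z')"
      using g ghost_merge_in_space[OF z z']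
      by (intro order.trans[OF abs_ge_self rademacher_sup_upper] ghost_signs)
    finally show "(\<Sum>i<n. g (z' (n + i))) - (\<Sum>i<n. g (z i))
        \<le> rademacher_sup (2 * n) G (ghost_signs n) (ghost_merge n z z')" .
  qed (rule integrable_ghost_sup[OF z])
  finally have "(1 / real n) * (real n * expectation g - (\<Sum>i<n. g (z i))) \<le> ghost_deviation n z"
    unfolding ghost_deviation_def by (intro mult_left_mono) auto
  then show ?thesis
    using n by (simp add: right_diff_distrib)
qed

section \<open>Concentration of the excess deviation\<close>

definition excess_deviation :: "nat \<Rightarrow> ('z \<Rightarrow> real) \<Rightarrow> (nat \<Rightarrow> 'z) \<Rightarrow> real" where
  "excess_deviation n g z = ghost_deviation n z + ((1 / real n) * (\<Sum>i<n. g (z i)) - expectation g)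
     - 2 * rademacher_avg n z G"

context
  fixes n :: nat and g0 :: "'z \<Rightarrow> real"
  assumes n: "n \<ge> 1" and g0: "g0 \<in> G"
begin

lemma measurable_excess_deviation: "excess_deviation n g0 \<in> borel_measurable (samples n)"
proof -
  have "(\<lambda>z. g0 (z i)) \<in> borel_measurable (samples n)" if "i \<in> {..<n}" for i
    using that by (intro measurable_compose[OF _ measurable_class[OF g0]] measurable_component_singleton)
  then show ?thesis
    unfolding excess_deviation_def
    by (intro borel_measurable_add borel_measurable_diff borel_measurable_times borel_measurable_sum
        borel_measurable_const measurable_ghost_deviation measurable_rademacher_avg)
qed

lemma empirical_mean_range:
  assumes "z \<in> space (samples n)"
  shows "(1 / real n) * (\<Sum>i<n. g0 (z i)) \<in> {0..M}"
proof -
  have "g0 (z i) \<in> {0..M}" if "i < n" for i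
    using assms that g0 by (intro class_range) (auto simp: space_PiM PiE_iff)
  then have "0 \<le> (\<Sum>i<n. g0 (z i))" "(\<Sum>i<n. g0 (z i)) \<le> real n * M"
    using sum_bounded_above[of "{..<n}" "\<lambda>i. g0 (z i)" M] by (auto intro: sum_nonneg)
  then show ?thesis
    using n by (simp add: field_simps)
qed

lemma expectation_range: "expectation g0 \<in> {0..M}"
proof -
  have "integrable D g0"
    using measurable_class[OF g0] abs_class_le[OF g0] by (rule integrable_if_bounded)
  then show ?thesis
    using class_range[OF g0] by (auto intro!: integral_ge_const integral_le_const AE_I2)
qed

lemma abs_excess_deviation_le:
  assumes z: "z \<in> space (samples n)"
  shows "\<bar>excess_deviation n g0 z\<bar> \<le> 5 * M"
proof -
  have "rademacher_avg n z G \<in> {0..M}"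
    using z n by (intro rademacher_avg_bounds) (auto simp: space_PiM PiE_iff)
  then show ?thesis
    using abs_ghost_deviation_le[OF n z] empirical_mean_range[OF z] expectation_range
    unfolding excess_deviation_def by auto
qed

lemma abs_excess_deviation_update_le:
  assumes z: "z \<in> space (samples n)" and y: "y \<in> space D" and j: "j < n"
  shows "\<bar>excess_deviation n g0 (z(j := y)) - excess_deviation n g0 z\<bar> \<le> 4 * M / real n"
proof -
  have zi: "\<And>i. i < n \<Longrightarrow> z i \<in> space D"
    using z by (auto simp: space_PiM PiE_iff)
  have "(\<Sum>i<n. g0 ((z(j := y)) i)) - (\<Sum>i<n. g0 (z i)) = (\<Sum>i<n. if i = j then g0 y - g0 (z j) else 0)"
    unfolding sum_subtractf[symmetric] by (intro sum.cong) auto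
  then have "\<bar>(\<Sum>i<n. g0 ((z(j := y)) i)) - (\<Sum>i<n. g0 (z i))\<bar> \<le> M"
    using abs_class_diff_le[OF g0 y zi[OF j]] j by simp
  then have "\<bar>(1 / real n) * (\<Sum>i<n. g0 ((z(j := y)) i)) - (1 / real n) * (\<Sum>i<n. g0 (z i))\<bar> \<le> M / real n"
    by (simp add: divide_right_mono flip: diff_divide_distrib)
  moreover have "\<bar>ghost_deviation n (z(j := y)) - ghost_deviation n z\<bar> \<le> M / real n"
    using n z y j by (rule abs_ghost_deviation_update_le)
  moreover have "\<bar>rademacher_avg n (z(j := y)) G - rademacher_avg n z G\<bar> \<le> M / real n"
    using n zi y j by (rule abs_rademacher_avg_update_le)
  ultimately show ?thesis
    unfolding excess_deviation_def by linarith
qed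

lemma expectation_excess_deviation_le: "(LINT z|samples n. excess_deviation n g0 z) \<le> 0"
proof -
  interpret P: prob_space "samples n" by (rule prob_space_PiM_D)
  have int_ghost: "integrable (samples n) (ghost_deviation n)"
    using measurable_ghost_deviation abs_ghost_deviation_le[OF n] by (rule P.integrable_if_bounded)
  have int_avg: "integrable (samples n) (\<lambda>z. rademacher_avg n z G)"
    using rademacher_avg_bounds[OF n]
    by (intro P.integrable_if_bounded[where B = M] measurable_rademacher_avg) (auto simp: space_PiM PiE_iff)
  have comp: "integrable (samples n) (\<lambda>z. g0 (z i))" "(LINT z|samples n. g0 (z i)) = expectation g0"
    if "i < n" for i
  proof -
    have m: "(\<lambda>z. z i) \<in> measurable (samples n) D"
      using that by (intro measurable_component_singleton) auto
    have d: "distr (samples n) D (\<lambda>z. z i) = D"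
      using that prob_space_axioms distr_PiM_component[of "{..<n}" "\<lambda>_. D" i] by simp
    show "(LINT z|samples n. g0 (z i)) = expectation g0"
      using integral_distr[OF m measurable_class[OF g0]] d by simp
    show "integrable (samples n) (\<lambda>z. g0 (z i))"
      using integrable_distr[OF m, of g0] integrable_if_bounded[OF measurable_class[OF g0] abs_class_le[OF g0]] d
      by simp
  qed
  have int_mean: "integrable (samples n) (\<lambda>z. (1 / real n) * (\<Sum>i<n. g0 (z i)))"
    using comp by (intro integrable_mult_right Bochner_Integration.integrable_sum) auto
  have "(LINT z|samples n. (1 / real n) * (\<Sum>i<n. g0 (z i))) = (1 / real n) * (\<Sum>i<n. expectation g0)"
    using comp by (subst integral_mult_right_zero) (auto simp: Bochner_Integration.integral_sum)
  then have mean: "(LINT z|samples n. (1 / real n) * (\<Sum>i<n. g0 (z i))) = expectation g0"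
    using n by simp
  have "(LINT z|samples n. excess_deviation n g0 z)
      = (LINT z|samples n. ghost_deviation n z)
        + ((LINT z|samples n. (1 / real n) * (\<Sum>i<n. g0 (z i))) - expectation g0)
        - 2 * (LINT z|samples n. rademacher_avg n z G)"
    unfolding excess_deviation_def using int_ghost int_avg int_mean by (simp add: P.prob_space)
  then show ?thesis
    unfolding mean using expectation_ghost_deviation_le[OF n] by simp
qed

text \<open>McDiarmid's inequality with \<open>n\<close> differences \<open>4 * M / n\<close>, whose squares add up to \<open>16 * M\<^sup>2 / n\<close>; the
  exponent at the stated threshold is \<open>- ln (1 / \<delta>)\<close>. If \<open>M = 0\<close> then both the
  threshold and the excess deviation vanish.\<close>

lemma excess_deviation_le_with_high_probability:
  assumes \<delta>: "0 < \<delta>" "\<delta> < 1"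
  shows "\<P>(z in samples n. excess_deviation n g0 z \<le> 4 * M * sqrt (ln (1 / \<delta>) / (2 * real n))) \<ge> 1 - \<delta>"
proof (cases "M = 0")
  case True
  interpret P: prob_space "samples n" by (rule prob_space_PiM_D)
  have "\<And>z. z \<in> space (samples n) \<Longrightarrow> excess_deviation n g0 z \<le> 0"
    using abs_excess_deviation_le True by fastforce
  then have "{z \<in> space (samples n). excess_deviation n g0 z \<le> 4 * M * sqrt (ln (1 / \<delta>) / (2 * real n))}
      = space (samples n)"
    using True by auto
  then show ?thesis
    using \<delta> by (simp add: P.prob_space)
next
  case False
  interpret P: prob_space "samples n" by (rule prob_space_PiM_D)
  let ?t = "4 * M * sqrt (ln (1 / \<delta>) / (2 * real n))"
  let ?E = "LINT z|samples n. excess_deviation n g0 z"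
  have M: "M > 0"
    using False M_nonneg by simp
  have L: "ln (1 / \<delta>) > 0"
    using \<delta> by simp
  have t: "?t > 0"
    using M L n by simp
  have C: "(\<Sum>i<n. (4 * M / real n)\<^sup>2) = 16 * M\<^sup>2 / real n"
    using n by (simp add: power2_eq_square field_simps)
  have C0: "(\<Sum>i<n. (4 * M / real n)\<^sup>2) > 0"
    unfolding C using M n by simp
  have "\<P>(z in samples n. excess_deviation n g0 z - ?E \<ge> ?t)
      \<le> exp (- 2 * ?t\<^sup>2 / (\<Sum>i<n. (4 * M / real n)\<^sup>2))"
    by (rule McDiarmid_inequality[OF _ prob_space_axioms measurable_excess_deviation
          abs_excess_deviation_le abs_excess_deviation_update_le t C0]) auto
  also have "?t\<^sup>2 = 8 * M\<^sup>2 * ln (1 / \<delta>) / real n"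
    using L n by (simp add: power_mult_distrib)
  also have "exp (- 2 * (8 * M\<^sup>2 * ln (1 / \<delta>) / real n) / (\<Sum>i<n. (4 * M / real n)\<^sup>2)) = exp (- ln (1 / \<delta>))"
    unfolding C using M n by simp
  also have "\<dots> = \<delta>"
    using \<delta> by (simp add: ln_div)
  finally have tail: "\<P>(z in samples n. excess_deviation n g0 z - ?E \<ge> ?t) \<le> \<delta>" .
  note [measurable] = measurable_excess_deviation
  have "1 - \<P>(z in samples n. excess_deviation n g0 z \<le> ?t)
      = \<P>(z in samples n. \<not> excess_deviation n g0 z \<le> ?t)"
    by (subst P.prob_neg) auto
  also have "\<dots> \<le> \<P>(z in samples n. excess_deviation n g0 z - ?E \<ge> ?t)"
    using expectation_excess_deviation_le by (intro P.finite_measure_mono) auto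
  finally show ?thesis
    using tail by simp
qed

end

end

text \<open>The uniform bound \<open>ghost_deviation_ge\<close> holds for every \<open>g\<close> in the class, so this may be applied to a \<open>g\<close> that
  depends on the sample \<open>z\<close> in an arbitrary, even nonmeasurable, way.\<close>

lemma (in bounded_function_class) empirical_mean_le_of_excess_deviation:
  assumes n: "n \<ge> 1" and z: "z \<in> space (samples n)" and g: "g \<in> G"
    and best: "expectation g0 \<le> expectation g"
    and dev: "excess_deviation n g0 z \<le> t"
  shows "(1 / real n) * (\<Sum>i<n. g0 (z i)) \<le> (1 / real n) * (\<Sum>i<n. g (z i)) + 2 * rademacher_avg n z G + t"
  using ghost_deviation_ge[OF n z g] best dev unfolding excess_deviation_def by linarith

section \<open>The uncertainty set and the two samples\<close>

text \<open>A residual in \<open>E\<close> is at most its supremum, and the value of \<open>\<beta>\<close> lies between the infimum and the supremum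
  over the models.\<close>

lemma in_uncertainty_set:
  assumes \<beta>: "\<beta> \<in> B" and E: "\<And>j. \<bar>u $ j - \<beta> (xt j)\<bar> \<in> E"
  shows "u \<in> uncertainty_set B E xt"
  unfolding uncertainty_set_def
proof (intro CollectI allI conjI)
  fix j
  define r where "r = \<bar>u $ j - \<beta> (xt j)\<bar>"
  have r: "ereal r \<le> ext_sup E"
    using E[of j] unfolding ext_sup_def r_def by (auto intro: SUP_upper)
  have "(INF \<beta>\<in>B. ereal (\<beta> (xt j))) - ext_sup E \<le> ereal (\<beta> (xt j)) - ereal r"
    using \<beta> r by (intro ereal_minus_mono INF_lower)
  also have "\<dots> \<le> ereal (u $ j)"
    by (simp add: r_def)
  finally show "(INF \<beta>\<in>B. ereal (\<beta> (xt j))) - ext_sup E \<le> ereal (u $ j)" .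
  have "ereal (u $ j) \<le> ereal (\<beta> (xt j)) + ereal r"
    by (simp add: r_def)
  also have "\<dots> \<le> ext_sup ((\<lambda>\<beta>. \<beta> (xt j)) ` B) + ext_sup E"
    using \<beta> r by (intro add_mono) (auto simp: ext_sup_def intro: SUP_upper)
  finally show "ereal (u $ j) \<le> ext_sup ((\<lambda>\<beta>. \<beta> (xt j)) ` B) + ext_sup E" .
qed

context prob_space
begin

context
  fixes D :: "'b measure" and Z :: "'i \<Rightarrow> 'a \<Rightarrow> 'b" and T :: "'j::finite \<Rightarrow> 'a \<Rightarrow> 'b" and I :: "'i set"
  assumes indep: "indep_vars (\<lambda>_. D) (case_sum Z T) (I <+> UNIV)"
begin

lemma measurable_two_samples:
  shows "i \<in> I \<Longrightarrow> Z i \<in> measurable M D" and "T j \<in> measurable M D"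
proof -
  have "case_sum Z T k \<in> measurable M D" if "k \<in> I <+> UNIV" for k
    using indep that by (auto simp: indep_vars_def)
  from this[of "Inl i"] this[of "Inr j"] show "i \<in> I \<Longrightarrow> Z i \<in> measurable M D" "T j \<in> measurable M D"
    by auto
qed

lemma distr_first_sample:
  assumes "I \<noteq> {}" and D: "prob_space D" and Z: "\<And>i. i \<in> I \<Longrightarrow> distr M D (Z i) = D"
  shows "distr M (PiM I (\<lambda>_. D)) (\<lambda>\<omega>. \<lambda>i\<in>I. Z i \<omega>) = PiM I (\<lambda>_. D)"
proof -
  let ?L = "Inl ` I :: ('i + 'j) set"
  let ?X = "\<lambda>\<omega>. \<lambda>k\<in>?L. case_sum Z T k \<omega>" and ?r = "\<lambda>w. \<lambda>i\<in>I. w (Inl i)"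
  have "indep_vars (\<lambda>_. D) (case_sum Z T) ?L"
    using indep by (rule indep_vars_subset) auto
  then have "distr M (PiM ?L (\<lambda>_. D)) ?X = PiM ?L (\<lambda>k. distr M D (case_sum Z T k))"
    using measurable_two_samples \<open>I \<noteq> {}\<close>
    by (subst (asm) indep_vars_iff_distr_eq_PiM') auto
  also have "\<dots> = PiM ?L (\<lambda>_. D)"
    using Z by (intro PiM_cong) auto
  finally have X: "distr M (PiM ?L (\<lambda>_. D)) ?X = PiM ?L (\<lambda>_. D)" .
  have "PiM I (\<lambda>_. D) = distr (PiM ?L (\<lambda>_. D)) (PiM I (\<lambda>_. D)) ?r"
    using D by (intro distr_PiM_reindex[symmetric]) auto
  also have "\<dots> = distr (distr M (PiM ?L (\<lambda>_. D)) ?X) (PiM I (\<lambda>_. D)) ?r"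
    unfolding X ..
  also have "\<dots> = distr M (PiM I (\<lambda>_. D)) (?r \<circ> ?X)"
    using measurable_two_samples
    by (intro distr_distr measurable_restrict measurable_component_singleton) auto
  also have "?r \<circ> ?X = (\<lambda>\<omega>. \<lambda>i\<in>I. Z i \<omega>)"
    by (auto simp: fun_eq_iff)
  finally show ?thesis ..
qed

lemma prob_two_samples:
  assumes A: "A \<in> sets (PiM I (\<lambda>_. D))" and C: "C \<in> sets D"
  shows "\<P>(\<omega> in M. (\<lambda>i\<in>I. Z i \<omega>) \<in> A \<and> (\<forall>j. T j \<omega> \<in> C))
       = \<P>(\<omega> in M. (\<lambda>i\<in>I. Z i \<omega>) \<in> A) * (\<Prod>j\<in>UNIV. \<P>(\<omega> in M. T j \<omega> \<in> C))"
proof -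
  let ?K = "range Inr :: ('i + 'j) set"
  let ?L = "Inl ` I :: ('i + 'j) set"
  let ?X = "\<lambda>\<omega>. \<lambda>k\<in>?L. case_sum Z T k \<omega>" and ?Y = "\<lambda>\<omega>. \<lambda>k\<in>?K. case_sum Z T k \<omega>"
  let ?r = "\<lambda>w. \<lambda>i\<in>I. w (Inl i)"
  define XA where "XA = ?r -` A \<inter> space (PiM ?L (\<lambda>_. D))"
  define YC where "YC = PiE ?K (\<lambda>_. C)"
  have "?r \<in> measurable (PiM ?L (\<lambda>_. D)) (PiM I (\<lambda>_. D))"
    by (intro measurable_restrict measurable_component_singleton) auto
  then have XA: "XA \<in> sets (PiM ?L (\<lambda>_. D))"
    unfolding XA_def using A by (rule measurable_sets)
  have YC: "YC \<in> sets (PiM ?K (\<lambda>_. D))"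
    unfolding YC_def using C by (intro sets_PiM_I_finite) auto
  have "indep_var (PiM ?L (\<lambda>_. D)) ?X (PiM ?K (\<lambda>_. D)) ?Y"
    using indep by (rule indep_var_restrict) auto
  from indep_varD[OF this XA YC]
  have split: "prob ((\<lambda>\<omega>. (?X \<omega>, ?Y \<omega>)) -` (XA \<times> YC) \<inter> space M)
      = prob (?X -` XA \<inter> space M) * prob (?Y -` YC \<inter> space M)" .
  have X_iff: "?X \<omega> \<in> XA \<longleftrightarrow> (\<lambda>i\<in>I. Z i \<omega>) \<in> A" if "\<omega> \<in> space M" for \<omega>
  proof -
    have "?X \<omega> \<in> space (PiM ?L (\<lambda>_. D))"
      using measurable_space[OF measurable_two_samples(1) that] by (auto simp: space_PiM)
    moreover have "?r (?X \<omega>) = (\<lambda>i\<in>I. Z i \<omega>)"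
      by (auto simp: fun_eq_iff)
    ultimately show ?thesis
      unfolding XA_def by simp
  qed
  have Y_iff: "?Y \<omega> \<in> YC \<longleftrightarrow> (\<forall>j. T j \<omega> \<in> C)" for \<omega>
    unfolding YC_def by (auto simp: PiE_iff)
  have "?Y -` YC \<inter> space M = (\<Inter>k\<in>?K. case_sum Z T k -` C \<inter> space M)"
    unfolding vimage_def Y_iff by auto
  also have "prob \<dots> = (\<Prod>k\<in>?K. prob (case_sum Z T k -` C \<inter> space M))"
    using C by (intro indep_varsD[OF indep]) auto
  also have "\<dots> = (\<Prod>j\<in>UNIV. prob (T j -` C \<inter> space M))"
    by (subst prod.reindex) auto
  also have "\<dots> = (\<Prod>j\<in>UNIV. \<P>(\<omega> in M. T j \<omega> \<in> C))"
    by (intro prod.cong arg_cong[where f = prob]) auto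
  finally have Y: "prob (?Y -` YC \<inter> space M) = (\<Prod>j\<in>UNIV. \<P>(\<omega> in M. T j \<omega> \<in> C))" .
  have X: "?X -` XA \<inter> space M = {\<omega> \<in> space M. (\<lambda>i\<in>I. Z i \<omega>) \<in> A}"
    using X_iff by auto
  have XY: "(\<lambda>\<omega>. (?X \<omega>, ?Y \<omega>)) -` (XA \<times> YC) \<inter> space M
      = {\<omega> \<in> space M. (\<lambda>i\<in>I. Z i \<omega>) \<in> A \<and> (\<forall>j. T j \<omega> \<in> C)}"
    using X_iff Y_iff by auto
  show ?thesis
    using split unfolding X XY Y .
qed

end

end

section \<open>Feasibility of the robust solution\<close>

theorem theorem6p1:
  fixes \<X> :: "(real ^ 'd) set" and \<Y> :: "real set"
    and D :: "((real ^ 'd) \<times> real) measure"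
    and \<Omega> :: "'w measure"
    and Z :: "nat \<Rightarrow> 'w \<Rightarrow> (real ^ 'd) \<times> real"
    and T :: "'m::finite \<Rightarrow> 'w \<Rightarrow> (real ^ 'd) \<times> real"
    and n :: nat
    and B0 :: "((real ^ 'd) \<Rightarrow> real) set"
    and l :: "real \<Rightarrow> real \<Rightarrow> real"
    and M \<delta> \<delta>e :: real
    and E :: "real set"
    and \<beta>star :: "(real ^ 'd) \<Rightarrow> real"
    and \<beta>alg :: "(nat \<Rightarrow> (real ^ 'd) \<times> real) \<Rightarrow> (real ^ 'd) \<Rightarrow> real"
    and P :: "(real ^ 'd1) set"
    and f :: "real ^ 'd1 \<Rightarrow> real ^ 'm \<Rightarrow> real"
    and F :: "real ^ 'd1 \<Rightarrow> real ^ 'm \<Rightarrow> real ^ 'd2"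
    and K :: "(real ^ 'd2) set"
    and \<pi>star :: "(real ^ 'm) set \<Rightarrow> real ^ 'd1"
  defines "S \<equiv> (\<lambda>\<omega>. \<lambda>i\<in>{..<n}. Z i \<omega>)"
  defines "\<B> \<equiv> (\<lambda>\<omega>. good_models n (S \<omega>) l M \<delta> B0 (\<beta>alg (S \<omega>)))"
  defines "\<U> \<equiv> (\<lambda>\<omega>. uncertainty_set (\<B> \<omega>) E (\<lambda>j. fst (T j \<omega>)))"
  assumes "n \<ge> 1"
    \<comment> \<open>the unknown distribution and the two independent i.i.d. samples\<close>
    and "prob_space D" and "sets D = sets (restrict_space borel (\<X> \<times> \<Y>))"
    and "prob_space \<Omega>"
    and "prob_space.indep_vars \<Omega> (\<lambda>_. D) (case_sum Z T) ({..<n} <+> (UNIV :: 'm set))"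
    and "\<And>i. i < n \<Longrightarrow> distr \<Omega> D (Z i) = D"
    and "\<And>j. distr \<Omega> D (T j) = D"
    \<comment> \<open>models, loss and minimizers\<close>
    and "\<And>\<beta>. \<beta> \<in> B0 \<Longrightarrow> \<beta> \<in> \<X> \<rightarrow> \<Y>"
    and "\<And>\<beta> x y. \<beta> \<in> B0 \<Longrightarrow> x \<in> \<X> \<Longrightarrow> y \<in> \<Y> \<Longrightarrow> l (\<beta> x) y \<in> {0..M}"
    and "is_arg_min (expected_loss D l) (\<lambda>\<beta>. \<beta> \<in> B0) \<beta>star"
    and "\<And>\<omega>. \<omega> \<in> space \<Omega> \<Longrightarrow> is_arg_min (empirical_loss n (S \<omega>) l) (\<lambda>\<beta>. \<beta> \<in> B0) (\<beta>alg (S \<omega>))"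
    and "E \<subseteq> \<Y>" and "\<delta>e \<in> {0..1}"
    and "\<P>(z in D. \<bar>snd z - \<beta>star (fst z)\<bar> \<in> E) \<ge> 1 - \<delta>e"
    and "\<delta> \<in> {0<..<1}"
    \<comment> \<open>the robust problem\<close>
    and "convex_cone K"
    and "\<And>\<omega>. \<omega> \<in> space \<Omega> \<Longrightarrow> robust_optimal P f F K (\<U> \<omega>) (\<pi>star (\<U> \<omega>))"
    \<comment> \<open>the measurability convention: losses, suprema in the Rademacher averages, events\<close>
    and "\<And>\<beta>. \<beta> \<in> B0 \<Longrightarrow> loss_of l \<beta> \<in> borel_measurable D"
    and "\<And>k \<sigma>. (\<And>i. i < k \<Longrightarrow> \<sigma> i \<in> {-1, 1}) \<Longrightarrow>
           rademacher_sup k (loss_of l ` B0) \<sigma> \<in> borel_measurable (Pi\<^sub>M {..<k} (\<lambda>_. D))"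
    and "{z \<in> space D. \<bar>snd z - \<beta>star (fst z)\<bar> \<in> E} \<in> sets D"
    and "{\<omega> \<in> space \<Omega>. \<beta>star \<in> \<B> \<omega>} \<in> sets \<Omega>"
    and "{\<omega> \<in> space \<Omega>. F (\<pi>star (\<U> \<omega>)) (\<chi> j. snd (T j \<omega>)) \<in> K} \<in> sets \<Omega>"
  shows "\<P>(\<omega> in \<Omega>. \<beta>star \<in> \<B> \<omega>) \<ge> 1 - \<delta> \<and>
         \<P>(\<omega> in \<Omega>. F (\<pi>star (\<U> \<omega>)) (\<chi> j. snd (T j \<omega>)) \<in> K) \<ge> (1 - \<delta>) * (1 - \<delta>e) ^ CARD('m)"
proof -
  have n: "n \<ge> 1" and D: "prob_space D" and sets_D: "sets D = sets (restrict_space borel (\<X> \<times> \<Y>))"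
    and \<Omega>: "prob_space \<Omega>"
    and indep: "prob_space.indep_vars \<Omega> (\<lambda>_. D) (case_sum Z T) ({..<n} <+> (UNIV :: 'm set))"
    and Z: "\<And>i. i < n \<Longrightarrow> distr \<Omega> D (Z i) = D" and T: "\<And>j. distr \<Omega> D (T j) = D"
    and loss: "\<And>\<beta> x y. \<beta> \<in> B0 \<Longrightarrow> x \<in> \<X> \<Longrightarrow> y \<in> \<Y> \<Longrightarrow> l (\<beta> x) y \<in> {0..M}"
    and star: "is_arg_min (expected_loss D l) (\<lambda>\<beta>. \<beta> \<in> B0) \<beta>star"
    and alg: "\<And>\<omega>. \<omega> \<in> space \<Omega> \<Longrightarrow> is_arg_min (empirical_loss n (S \<omega>) l) (\<lambda>\<beta>. \<beta> \<in> B0) (\<beta>alg (S \<omega>))"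
    and \<delta>e: "\<delta>e \<in> {0..1}"
    and cover: "\<P>(z in D. \<bar>snd z - \<beta>star (fst z)\<bar> \<in> E) \<ge> 1 - \<delta>e"
    and \<delta>: "\<delta> \<in> {0<..<1}"
    and robust: "\<And>\<omega>. \<omega> \<in> space \<Omega> \<Longrightarrow> robust_optimal P f F K (\<U> \<omega>) (\<pi>star (\<U> \<omega>))"
    and loss_measurable: "\<And>\<beta>. \<beta> \<in> B0 \<Longrightarrow> loss_of l \<beta> \<in> borel_measurable D"
    and sup_measurable: "\<And>k \<sigma>. (\<And>i. i < k \<Longrightarrow> \<sigma> i \<in> {-1, 1}) \<Longrightarrow>
           rademacher_sup k (loss_of l ` B0) \<sigma> \<in> borel_measurable (Pi\<^sub>M {..<k} (\<lambda>_. D))"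
    and cover_event: "{z \<in> space D. \<bar>snd z - \<beta>star (fst z)\<bar> \<in> E} \<in> sets D"
    and star_event: "{\<omega> \<in> space \<Omega>. \<beta>star \<in> \<B> \<omega>} \<in> sets \<Omega>"
    and feasible_event: "{\<omega> \<in> space \<Omega>. F (\<pi>star (\<U> \<omega>)) (\<chi> j. snd (T j \<omega>)) \<in> K} \<in> sets \<Omega>"
    by (fact assms)+
  interpret \<Omega>: prob_space \<Omega> by (fact \<Omega>)
  have space_D: "space D = \<X> \<times> \<Y>"
    using sets_eq_imp_space_eq[OF sets_D] by (simp add: space_restrict_space)
  have star_in: "\<beta>star \<in> B0"
    using star by (simp add: is_arg_min_def)
  interpret D: bounded_function_class D "loss_of l ` B0" M
    unfolding bounded_function_class_def bounded_function_class_axioms_def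
    using D star_in loss_measurable sup_measurable loss by (auto simp: loss_of_def space_D)
  let ?g = "loss_of l \<beta>star"
  let ?t = "4 * M * sqrt (ln (3 / \<delta>) / (2 * real n))"
  define A where "A = {z \<in> space (D.samples n). D.excess_deviation n ?g z \<le> ?t}"
  define C where "C = {z \<in> space D. \<bar>snd z - \<beta>star (fst z)\<bar> \<in> E}"
  have g: "?g \<in> loss_of l ` B0"
    using star_in by simp
  have A: "A \<in> sets (D.samples n)"
    unfolding A_def using D.measurable_excess_deviation[OF n g] by measurable
  have S_measurable: "S \<in> measurable \<Omega> (D.samples n)"
    unfolding S_def using \<Omega>.measurable_two_samples[OF indep] by (intro measurable_restrict) auto
  have S_space: "S \<omega> \<in> space (D.samples n)" if "\<omega> \<in> space \<Omega>" for \<omega>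
    using measurable_space[OF S_measurable that] .
  have S_distr: "distr \<Omega> (D.samples n) S = D.samples n"
    unfolding S_def using n D Z by (intro \<Omega>.distr_first_sample[OF indep]) (auto simp: lessThan_empty_iff)
  have "\<P>(\<omega> in \<Omega>. S \<omega> \<in> A) = measure (distr \<Omega> (D.samples n) S) A"
    using S_measurable A by (subst measure_distr) (auto intro!: arg_cong[where f = \<Omega>.prob])
  also have "\<dots> \<ge> 1 - \<delta> / 3"
    unfolding S_distr A_def
    using D.excess_deviation_le_with_high_probability[OF n g, of "\<delta> / 3"] \<delta> by simp
  \<comment> \<open>a third of the permitted failure probability suffices: there is a single bad event\<close>
  finally have prob_A: "\<P>(\<omega> in \<Omega>. S \<omega> \<in> A) \<ge> 1 - \<delta>"
    using \<delta> by simp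
  have star_good: "\<beta>star \<in> \<B> \<omega>" if \<omega>: "\<omega> \<in> space \<Omega>" and "S \<omega> \<in> A" for \<omega>
  proof -
    have alg_in: "\<beta>alg (S \<omega>) \<in> B0"
      using alg[OF \<omega>] by (simp add: is_arg_min_def)
    then have "D.expectation ?g \<le> D.expectation (loss_of l (\<beta>alg (S \<omega>)))"
      using star unfolding is_arg_min_linorder expected_loss_def by auto
    then have "(1 / real n) * (\<Sum>i<n. ?g (S \<omega> i))
        \<le> (1 / real n) * (\<Sum>i<n. loss_of l (\<beta>alg (S \<omega>)) (S \<omega> i)) + 2 * rademacher_avg n (S \<omega>) (loss_of l ` B0) + ?t"
      using \<open>S \<omega> \<in> A\<close> alg_in unfolding A_def
      by (intro D.empirical_mean_le_of_excess_deviation n) auto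
    then show ?thesis
      unfolding \<B>_def good_models_def empirical_loss_def using star_in by simp
  qed
  have "\<P>(\<omega> in \<Omega>. S \<omega> \<in> A) \<le> \<P>(\<omega> in \<Omega>. \<beta>star \<in> \<B> \<omega>)"
    using star_good star_event by (intro \<Omega>.finite_measure_mono) auto
  with prob_A have part1: "\<P>(\<omega> in \<Omega>. \<beta>star \<in> \<B> \<omega>) \<ge> 1 - \<delta>"
    by simp
  have prob_C: "\<P>(\<omega> in \<Omega>. T j \<omega> \<in> C) \<ge> 1 - \<delta>e" for j
  proof -
    have "\<P>(\<omega> in \<Omega>. T j \<omega> \<in> C) = measure (distr \<Omega> D (T j)) C"
      using \<Omega>.measurable_two_samples(2)[OF indep] cover_event unfolding C_def
      by (subst measure_distr) (auto intro!: arg_cong[where f = \<Omega>.prob])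
    then show ?thesis
      using cover unfolding T C_def by simp
  qed
  have "(1 - \<delta>) * (1 - \<delta>e) ^ CARD('m) = (1 - \<delta>) * (\<Prod>j\<in>(UNIV :: 'm set). 1 - \<delta>e)"
    by simp
  also have "\<dots> \<le> \<P>(\<omega> in \<Omega>. S \<omega> \<in> A) * (\<Prod>j\<in>UNIV. \<P>(\<omega> in \<Omega>. T j \<omega> \<in> C))"
    using prob_A prob_C \<delta>e by (intro mult_mono prod_mono prod_nonneg) auto
  also have "\<dots> = \<P>(\<omega> in \<Omega>. S \<omega> \<in> A \<and> (\<forall>j. T j \<omega> \<in> C))"
    unfolding S_def using cover_event A unfolding C_def by (intro \<Omega>.prob_two_samples[OF indep, symmetric]) auto
  also have "\<dots> \<le> \<P>(\<omega> in \<Omega>. F (\<pi>star (\<U> \<omega>)) (\<chi> j. snd (T j \<omega>)) \<in> K)"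
  proof (intro \<Omega>.finite_measure_mono feasible_event subsetI)
    fix \<omega> assume "\<omega> \<in> {\<omega> \<in> space \<Omega>. S \<omega> \<in> A \<and> (\<forall>j. T j \<omega> \<in> C)}"
    then have \<omega>: "\<omega> \<in> space \<Omega>" "S \<omega> \<in> A" and TC: "\<And>j. T j \<omega> \<in> C"
      by auto
    have "(\<chi> j. snd (T j \<omega>)) \<in> \<U> \<omega>"
      unfolding \<U>_def using star_good[OF \<omega>] TC by (intro in_uncertainty_set) (auto simp: C_def)
    then have "F (\<pi>star (\<U> \<omega>)) (\<chi> j. snd (T j \<omega>)) \<in> K"
      using robust[OF \<omega>(1)] by (auto simp: robust_optimal_def is_arg_min_def robust_feasible_def)
    with \<omega> show "\<omega> \<in> {\<omega> \<in> space \<Omega>. F (\<pi>star (\<U> \<omega>)) (\<chi> j. snd (T j \<omega>)) \<in> K}"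
      by simp
  qed
  finally show ?thesis
    using part1 by simp
qed

end
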